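(* Let $K$ be an infinite set. Then no tree set of bipartitions of $K$ distinguishes all the free ultrafilters on $K$; that is, for every tree set $\vec T$ of bipartitions of $K$ there are two distinct free ultrafilters $U\neq U'$ on $K$ such that there is no $Z\in\vec T$ with $Z\in U$ and $K\setminus Z\in U'$.
   Context: For a non-empty set $K$, let $\vec{\mathcal B}(K)=2^K$ (the set of all subsets of $K$), partially ordered by $Z_1\le Z_2$ iff $Z_1\supseteq Z_2$, with the involution $Z\mapsto Z^*:=K\setminus Z$; $Z$ is thought of as the oriented bipartition $(Z^*,Z)$, and the (unoriented) bipartition is $\{Z,Z^*\}$. Two elements $Z_1,Z_2$ are nested if $Z_1\subseteq Z_2$ or $Z_1\supseteq Z_2$ or $Z_1\cup Z_2=K$ or $Z_1\cap Z_2=\emptyset$. A tree set of bipartitions of $K$ is a subset $\vec T\subseteq 2^K$ closed under $Z\mapsto Z^*$, any two of whose elements are nested, containing no degenerate element ($Z=Z^*$) and no trivial element, where $Z\in\vec T$ is trivial if there is $W\in\vec T$ with $W\notin\{Z,Z^*\}$ such that $Z<W$ and $Z<W^*$ (in the order $\le$ above). $\vec T$ distinguishes two ultrafilters $U\ne U'$ on $K$ if some $Z\in\vec T$ has $Z\in U$ and $Z^*\in U'$. *)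

theory Defs
  imports Main
begin

text \<open>
  Throughout, \<open>K\<close> is the ground set. A subset \<open>Z\<close> of \<open>K\<close> stands for the oriented bipartition
  \<open>(K - Z, Z)\<close>; the set of all of them is \<open>Pow K\<close>.
\<close>

definition bip_inv :: "'a set \<Rightarrow> 'a set \<Rightarrow> 'a set" where
  "bip_inv K Z = K - Z"

text \<open>The order on oriented bipartitions is reverse inclusion.\<close>

definition bip_le :: "'a set \<Rightarrow> 'a set \<Rightarrow> bool" where
  "bip_le Z W \<longleftrightarrow> Z \<supseteq> W"

definition bip_less :: "'a set \<Rightarrow> 'a set \<Rightarrow> bool" where
  "bip_less Z W \<longleftrightarrow> bip_le Z W \<and> Z \<noteq> W"

definition bip_nested :: "'a set \<Rightarrow> 'a set \<Rightarrow> 'a set \<Rightarrow> bool" where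
  "bip_nested K Z W \<longleftrightarrow> Z \<subseteq> W \<or> Z \<supseteq> W \<or> Z \<union> W = K \<or> Z \<inter> W = {}"

definition bip_degenerate :: "'a set \<Rightarrow> 'a set \<Rightarrow> bool" where
  "bip_degenerate K Z \<longleftrightarrow> Z = bip_inv K Z"

definition bip_trivial_in :: "'a set \<Rightarrow> 'a set set \<Rightarrow> 'a set \<Rightarrow> bool" where
  "bip_trivial_in K T Z \<longleftrightarrow>
     (\<exists>W\<in>T. W \<notin> {Z, bip_inv K Z} \<and> bip_less Z W \<and> bip_less Z (bip_inv K W))"

definition bip_tree_set :: "'a set \<Rightarrow> 'a set set \<Rightarrow> bool" where
  "bip_tree_set K T \<longleftrightarrow>
     T \<subseteq> Pow K \<and>
     (\<forall>Z\<in>T. bip_inv K Z \<in> T) \<and>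
     (\<forall>Z\<in>T. \<forall>W\<in>T. bip_nested K Z W) \<and>
     (\<forall>Z\<in>T. \<not> bip_degenerate K Z) \<and>
     (\<forall>Z\<in>T. \<not> bip_trivial_in K T Z)"

definition filter_on :: "'a set \<Rightarrow> 'a set set \<Rightarrow> bool" where
  "filter_on K U \<longleftrightarrow>
     U \<subseteq> Pow K \<and> K \<in> U \<and> {} \<notin> U \<and>
     (\<forall>A\<in>U. \<forall>B\<in>U. A \<inter> B \<in> U) \<and>
     (\<forall>A\<in>U. \<forall>B. A \<subseteq> B \<and> B \<subseteq> K \<longrightarrow> B \<in> U)"

definition ultrafilter_on :: "'a set \<Rightarrow> 'a set set \<Rightarrow> bool" where
  "ultrafilter_on K U \<longleftrightarrow> filter_on K U \<and> (\<forall>A. A \<subseteq> K \<longrightarrow> A \<in> U \<or> K - A \<in> U)"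

text \<open>Free means non-principal: no point of \<open>K\<close> lies in all members.\<close>

definition free_ultrafilter_on :: "'a set \<Rightarrow> 'a set set \<Rightarrow> bool" where
  "free_ultrafilter_on K U \<longleftrightarrow> ultrafilter_on K U \<and> \<Inter>U = {}"

definition distinguishes :: "'a set \<Rightarrow> 'a set set \<Rightarrow> 'a set set \<Rightarrow> 'a set set \<Rightarrow> bool" where
  "distinguishes K T U U' \<longleftrightarrow> (\<exists>Z\<in>T. Z \<in> U \<and> bip_inv K Z \<in> U')"

end

theory Submission
  imports Defs "HOL-Library.Ramsey"
begin

text \<open>
  Fix a point \<open>p\<close> of \<open>K\<close>. Choosing from each bipartition the side that avoids \<open>p\<close> turns \<open>T\<close> into a
  laminar family (any two members are comparable or disjoint). On a sequence of points of \<open>K\<close>, colour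
  a triple \<open>x < y < z\<close> according to whether some member of the family contains \<open>y\<close> and \<open>z\<close> but
  not \<open>x\<close>. Laminarity implies that on a Ramsey-homogeneous infinite set \<open>X\<close> every member is finite
  or cofinite. Hence \<open>T\<close> does not distinguish any two free ultrafilters that contain \<open>X\<close>, and there
  are two distinct ones because \<open>X\<close> splits into two infinite sets.
\<close>

definition laminar :: "'a set set \<Rightarrow> bool" where
  "laminar S \<longleftrightarrow> (\<forall>Z\<in>S. \<forall>W\<in>S. Z \<subseteq> W \<or> W \<subseteq> Z \<or> Z \<inter> W = {})"

lemma laminar_nat_almost_constant:
  fixes S :: "nat set set"
  assumes "laminar S"
  obtains X where "infinite X" "\<And>Z. Z \<in> S \<Longrightarrow> finite (X \<inter> Z) \<or> finite (X - Z)"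
proof -
  \<comment> \<open>\<open>Ramsey\<close> colours unordered sets, so \<open>Min\<close> recovers
    which point of the triple has to be left out.\<close>
  define f where "f A = (if \<exists>Z\<in>S. Z \<inter> A = A - {Min A} then 1 else 0 :: nat)" for A
  have "\<forall>A. A \<subseteq> UNIV \<and> finite A \<and> card A = 3 \<longrightarrow> f A < 2"
    by (simp add: f_def)
  from Ramsey[OF infinite_UNIV_nat this] obtain X t where X: "infinite X"
    and hom: "\<And>A. A \<subseteq> X \<Longrightarrow> finite A \<Longrightarrow> card A = 3 \<Longrightarrow> f A = t"
    by (metis (no_types))
  have f_iff: "f {x, y, z} = 1 \<longleftrightarrow> (\<exists>W\<in>S. x \<notin> W \<and> y \<in> W \<and> z \<in> W)"
    if "x < y" "y < z" for x y z
  proof -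
    have "Min {x, y, z} = x" using that by (intro Min_eqI) auto
    then have "W \<inter> {x, y, z} = {x, y, z} - {Min {x, y, z}} \<longleftrightarrow> x \<notin> W \<and> y \<in> W \<and> z \<in> W" for W
      using that by auto
    then show ?thesis by (simp add: f_def)
  qed
  have col: "f {x, y, z} = t" if "x < y" "y < z" "x \<in> X" "y \<in> X" "z \<in> X" for x y z
    using that by (intro hom) auto
  have "finite (X \<inter> Z) \<or> finite (X - Z)" if Z: "Z \<in> S" for Z
  proof (rule ccontr)
    assume "\<not> ?thesis"
    then have inf: "infinite (X \<inter> Z)" "infinite (X - Z)" by auto
    then have above: "\<exists>z>n. z \<in> X \<and> z \<in> Z" "\<exists>y>n. y \<in> X \<and> y \<notin> Z" for n
      unfolding infinite_nat_iff_unbounded by blast+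
    \<comment> \<open>Read in increasing order, \<open>y\<close>, \<open>z\<close>,
      \<open>z'\<close> have the pattern out, in, in with respect to \<open>Z\<close>. So
      \<open>Z\<close> itself witnesses colour 1, which fixes \<open>t\<close>.\<close>
    obtain y where y: "y \<in> X" "y \<notin> Z" using above by blast
    obtain z where z: "y < z" "z \<in> X" "z \<in> Z" using above by blast
    obtain z' where z': "z < z'" "z' \<in> X" "z' \<in> Z" using above by blast
    have "f {y, z, z'} = 1" using f_iff y z z' Z by blast
    then have "t = 1" using col y z z' by simp
    \<comment> \<open>Now the pattern is in, out, in. Homogeneity still yields some \<open>W\<close>
      that omits \<open>z\<close> and contains \<open>v\<close> and \<open>w\<close>. Then
      \<open>z\<close> lies only in \<open>Z\<close>, \<open>v\<close> only in \<open>W\<close> and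
      \<open>w\<close> in both, so \<open>Z\<close> and \<open>W\<close> cross.\<close>
    obtain v where v: "z < v" "v \<in> X" "v \<notin> Z" using above by blast
    obtain w where w: "v < w" "w \<in> X" "w \<in> Z" using above by blast
    have "f {z, v, w} = 1" using col z v w \<open>t = 1\<close> by simp
    then obtain W where "W \<in> S" "z \<notin> W" "v \<in> W" "w \<in> W" using f_iff v w by blast
    then show False
      using assms Z z v w unfolding laminar_def by blast
  qed
  with X that show thesis by blast
qed

text \<open>Preimages under an injection \<open>g\<close> from the naturals into \<open>K\<close>
  preserve laminarity, and \<open>g\<close> carries the resulting infinite set back into
  \<open>K\<close>.\<close>

lemma laminar_almost_constant:
  assumes "laminar S" "infinite K"
  obtains X where "X \<subseteq> K" "infinite X" "\<And>Z. Z \<in> S \<Longrightarrow> finite (X \<inter> Z) \<or> finite (X - Z)"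
proof -
  obtain g :: "nat \<Rightarrow> 'a" where g: "inj g" "range g \<subseteq> K"
    using infinite_countable_subset[OF assms(2)] by blast
  have "laminar ((-`) g ` S)"
    using assms(1) unfolding laminar_def by blast
  then obtain Y where Y: "infinite Y"
    "\<And>Z. Z \<in> (-`) g ` S \<Longrightarrow> finite (Y \<inter> Z) \<or> finite (Y - Z)"
    using laminar_nat_almost_constant by blast
  have "g ` Y \<inter> Z = g ` (Y \<inter> g -` Z)" "g ` Y - Z = g ` (Y - g -` Z)" for Z
    by auto
  then have "finite (g ` Y \<inter> Z) \<or> finite (g ` Y - Z)" if "Z \<in> S" for Z
    using Y(2)[of "g -` Z"] that by auto
  moreover have "infinite (g ` Y)"
    using Y(1) g(1) by (meson finite_imageD inj_on_subset subset_UNIV)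
  ultimately show thesis using g(2) by (intro that[of "g ` Y"]) auto
qed

text \<open>The upper bound needed for Zorn's lemma. Comparability matters for intersections: two
  sets taken from different filters of the chain both lie in the larger filter. Non-emptiness of the
  chain puts \<open>K\<close> into the union.\<close>

lemma filter_on_Union_chain:
  assumes "\<C> \<noteq> {}" "subset.chain {F. filter_on K F} \<C>"
  shows "filter_on K (\<Union>\<C>)"
proof -
  have F: "F \<subseteq> Pow K" "K \<in> F" "{} \<notin> F" "\<And>A B. A \<in> F \<Longrightarrow> B \<in> F \<Longrightarrow> A \<inter> B \<in> F"
    "\<And>A B. A \<in> F \<Longrightarrow> A \<subseteq> B \<Longrightarrow> B \<subseteq> K \<Longrightarrow> B \<in> F" if "F \<in> \<C>" for F
  proof -
    have "filter_on K F" using assms(2) that unfolding subset.chain_def by blast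
    note this[unfolded filter_on_def]
    then show "F \<subseteq> Pow K" "K \<in> F" "{} \<notin> F" "\<And>A B. A \<in> F \<Longrightarrow> B \<in> F \<Longrightarrow> A \<inter> B \<in> F"
      "\<And>A B. A \<in> F \<Longrightarrow> A \<subseteq> B \<Longrightarrow> B \<subseteq> K \<Longrightarrow> B \<in> F"
      by blast+
  qed
  have inter: "A \<inter> B \<in> \<Union>\<C>" if "A \<in> F" "F \<in> \<C>" "B \<in> G" "G \<in> \<C>" for A B F G
  proof -
    have "F \<subseteq> G \<or> G \<subseteq> F" using assms(2) that by (auto simp: subset.chain_def)
    then show ?thesis using that F(4) by (meson UnionI subsetD)
  qed
  then show ?thesis
    unfolding filter_on_def
  proof (intro conjI ballI allI impI)
    show "K \<in> \<Union>\<C>" using assms(1) F(2) by (meson UnionI ex_in_conv)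
    show "A \<inter> B \<in> \<Union>\<C>" if "A \<in> \<Union>\<C>" "B \<in> \<Union>\<C>" for A B
      using that inter by (elim UnionE)
    show "B \<in> \<Union>\<C>" if "A \<in> \<Union>\<C>" "A \<subseteq> B \<and> B \<subseteq> K" for A B
      using that F(5) by (meson UnionE UnionI)
    show "{} \<notin> \<Union>\<C>" using F(3) by (meson UnionE)
    show "\<Union>\<C> \<subseteq> Pow K" using F(1) by (meson Union_least)
  qed
qed

lemma filter_on_extends_to_ultrafilter_on:
  assumes "filter_on K F"
  obtains U where "ultrafilter_on K U" "F \<subseteq> U"
proof -
  let ?A = "{G. filter_on K G \<and> F \<subseteq> G}"
  have "\<exists>M\<in>?A. \<forall>X\<in>?A. M \<subseteq> X \<longrightarrow> X = M"
  proof (rule subset_Zorn_nonempty)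
    show "?A \<noteq> {}" using assms by blast
    fix \<C> assume C: "\<C> \<noteq> {}" "subset.chain ?A \<C>"
    then have "subset.chain {G. filter_on K G} \<C>" by (auto simp: subset.chain_def)
    then have "filter_on K (\<Union>\<C>)" using C(1) filter_on_Union_chain by blast
    moreover have "F \<subseteq> \<Union>\<C>" using C unfolding subset.chain_def by blast
    ultimately show "\<Union>\<C> \<in> ?A" by blast
  qed
  then obtain M where "M \<in> ?A" and *: "\<forall>G\<in>?A. M \<subseteq> G \<longrightarrow> G = M"
    by (rule bexE)
  then have M: "filter_on K M" "F \<subseteq> M" by simp_all
  have max: "G = M" if "filter_on K G" "M \<subseteq> G" for G
    using * that M(2) by simp
  have M': "M \<subseteq> Pow K" "K \<in> M" "\<And>A B. A \<in> M \<Longrightarrow> B \<in> M \<Longrightarrow> A \<inter> B \<in> M"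
    "\<And>A B. A \<in> M \<Longrightarrow> A \<subseteq> B \<Longrightarrow> B \<subseteq> K \<Longrightarrow> B \<in> M"
    using M(1) unfolding filter_on_def by simp_all
  have "C \<in> M \<or> K - C \<in> M" if C: "C \<subseteq> K" for C
  proof (cases "\<exists>D\<in>M. D \<inter> C = {}")
    case True
    then obtain D where "D \<in> M" "D \<subseteq> K - C" using M'(1) by blast
    then have "K - C \<in> M" using M'(4) by blast
    then show ?thesis ..
  next
    case False
    \<comment> \<open>The filter generated by \<open>M\<close> and \<open>C\<close>. It is proper
      because \<open>C\<close> meets every member of \<open>M\<close>, so maximality of
      \<open>M\<close> forces \<open>C\<close> into \<open>M\<close>.\<close>
    define G where "G = {B. B \<subseteq> K \<and> (\<exists>D\<in>M. D \<inter> C \<subseteq> B)}"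
    have "A \<inter> B \<in> G" if AB: "A \<in> G" "B \<in> G" for A B
    proof -
      obtain D E where "D \<in> M" "D \<inter> C \<subseteq> A" "E \<in> M" "E \<inter> C \<subseteq> B"
        using AB unfolding G_def by blast
      then have "D \<inter> E \<in> M" "(D \<inter> E) \<inter> C \<subseteq> A \<inter> B" using M'(3) by auto
      then show ?thesis using AB unfolding G_def by blast
    qed
    moreover have "{} \<notin> G" using False unfolding G_def by blast
    moreover have "K \<in> G" using M'(2) unfolding G_def by blast
    moreover have "B \<in> G" if "A \<in> G" "A \<subseteq> B" "B \<subseteq> K" for A B
      using that unfolding G_def by blast
    moreover have "G \<subseteq> Pow K" unfolding G_def by blast
    ultimately have "filter_on K G" unfolding filter_on_def by simp
    moreover have "M \<subseteq> G" using M'(1) unfolding G_def by blast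
    moreover have "C \<in> G" using M'(2) C unfolding G_def by blast
    ultimately show ?thesis using max by metis
  qed
  then have "ultrafilter_on K M" using M(1) unfolding ultrafilter_on_def by simp
  then show thesis using M(2) by (rule that)
qed

text \<open>The sets containing all but finitely many points of \<open>A\<close> form a filter,
  proper since \<open>A\<close> is infinite. Any ultrafilter extending it contains the complement of
  each point and is therefore free.\<close>

lemma free_ultrafilter_on_exists:
  assumes "A \<subseteq> K" "infinite A"
  obtains U where "free_ultrafilter_on K U" "\<And>B. B \<subseteq> K \<Longrightarrow> finite (A - B) \<Longrightarrow> B \<in> U"
proof -
  let ?F = "{B. B \<subseteq> K \<and> finite (A - B)}"
  have "filter_on K ?F"
    unfolding filter_on_def
  proof (intro conjI ballI allI impI)
    show "K \<in> ?F" using assms(1) by (simp add: Diff_eq_empty_iff[THEN iffD2])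
    fix B assume B: "B \<in> ?F"
    show "B \<inter> C \<in> ?F" if "C \<in> ?F" for C
      using that B by (auto simp: Diff_Int)
    show "C \<in> ?F" if "B \<subseteq> C \<and> C \<subseteq> K" for C
      using that B by (auto intro: finite_subset[of "A - C" "A - B"])
  qed (use assms(2) in auto)
  then obtain U where U: "ultrafilter_on K U" "?F \<subseteq> U"
    by (rule filter_on_extends_to_ultrafilter_on)
  have "K - {x} \<in> U" for x
  proof -
    have "A - (K - {x}) \<subseteq> {x}" using assms(1) by blast
    then have "finite (A - (K - {x}))" using finite_subset by blast
    then show ?thesis using U(2) by blast
  qed
  then have "\<Inter>U = {}" by blast
  with U that show thesis unfolding free_ultrafilter_on_def by blast
qed

lemma bip_tree_set_almost_constant:
  assumes "infinite K" "bip_tree_set K T"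
  obtains X where "X \<subseteq> K" "infinite X" "\<And>Z. Z \<in> T \<Longrightarrow> finite (X \<inter> Z) \<or> finite (X - Z)"
proof -
  obtain p where p: "p \<in> K" using assms(1) by (metis ex_in_conv finite.emptyI)
  have T: "T \<subseteq> Pow K" "\<And>Z. Z \<in> T \<Longrightarrow> K - Z \<in> T"
    "\<And>Z W. Z \<in> T \<Longrightarrow> W \<in> T \<Longrightarrow> bip_nested K Z W"
    using assms(2) by (auto simp: bip_tree_set_def bip_inv_def)
  \<comment> \<open>Of the four ways of being nested, covering \<open>K\<close> is impossible here,
    since \<open>p\<close> lies in neither set. The other three are laminarity.\<close>
  have "laminar {Z \<in> T. p \<notin> Z}"
    unfolding laminar_def using T(3) p by (fastforce simp: bip_nested_def)
  then obtain X where X: "X \<subseteq> K" "infinite X"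
    "\<And>Z. Z \<in> {Z \<in> T. p \<notin> Z} \<Longrightarrow> finite (X \<inter> Z) \<or> finite (X - Z)"
    using laminar_almost_constant assms(1) by blast
  have "finite (X \<inter> Z) \<or> finite (X - Z)" if Z: "Z \<in> T" for Z
  \<comment> \<open>Passing to the complement only swaps the two alternatives, so the side
    containing \<open>p\<close> inherits the property.\<close>
  proof (cases "p \<in> Z")
    case True
    have "X \<inter> (K - Z) = X - Z" "X - (K - Z) = X \<inter> Z" using X(1) by auto
    then show ?thesis using X(3)[of "K - Z"] T(2)[OF Z] True by auto
  qed (use X(3) Z in blast)
  with X(1,2) that show thesis by blast
qed

theorem theorem3p3:
  fixes K :: "'a set" and T :: "'a set set"
  assumes "infinite K"
    and "bip_tree_set K T"
  shows "\<exists>U U'. free_ultrafilter_on K U \<and> free_ultrafilter_on K U' \<and> U \<noteq> U' \<and>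
           \<not> distinguishes K T U U'"
proof -
  obtain X where X: "X \<subseteq> K" "infinite X"
    "\<And>Z. Z \<in> T \<Longrightarrow> finite (X \<inter> Z) \<or> finite (X - Z)"
    by (rule bip_tree_set_almost_constant[OF assms]) simp
  \<comment> \<open>The disjoint halves become members of \<open>U\<close> and \<open>U'\<close>
    respectively, which makes the two ultrafilters distinct.\<close>
  obtain A B where AB: "A \<subseteq> X" "B \<subseteq> X" "infinite A" "infinite B" "A \<inter> B = {}"
    by (rule infinite_split[OF X(2)])
  then have "A \<subseteq> K" "B \<subseteq> K" using X(1) by simp_all
  obtain U where U: "free_ultrafilter_on K U" "\<And>C. C \<subseteq> K \<Longrightarrow> finite (A - C) \<Longrightarrow> C \<in> U"
    by (rule free_ultrafilter_on_exists[OF \<open>A \<subseteq> K\<close> \<open>infinite A\<close>]) simp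
  obtain U' where U': "free_ultrafilter_on K U'" "\<And>C. C \<subseteq> K \<Longrightarrow> finite (B - C) \<Longrightarrow> C \<in> U'"
    by (rule free_ultrafilter_on_exists[OF \<open>B \<subseteq> K\<close> \<open>infinite B\<close>]) simp
  have disj: "C \<inter> D \<noteq> {}" if "free_ultrafilter_on K V" "C \<in> V" "D \<in> V" for V C D
    using that unfolding free_ultrafilter_on_def ultrafilter_on_def filter_on_def by metis
  have "A \<in> U" "B \<in> U'" using U(2) U'(2) \<open>A \<subseteq> K\<close> \<open>B \<subseteq> K\<close> by simp_all
  then have "U \<noteq> U'" using disj U(1) AB(5) by blast
  moreover have "\<not> distinguishes K T U U'"
  proof
    assume "distinguishes K T U U'"
    then obtain Z where Z: "Z \<in> T" "Z \<in> U" "K - Z \<in> U'"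
      by (auto simp: distinguishes_def bip_inv_def)
    have "Z \<subseteq> K" using assms(2) Z(1) by (auto simp: bip_tree_set_def)
    \<comment> \<open>Whichever side of \<open>Z\<close> contains almost all of \<open>X\<close>
      contains almost all of \<open>A\<close> and of \<open>B\<close>, hence belongs to both
      ultrafilters. One of them then contains both \<open>Z\<close> and its complement.\<close>
    from X(3)[OF Z(1)] show False
    proof
      assume "finite (X \<inter> Z)"
      then have "finite (A - (K - Z))"
        by (rule rev_finite_subset) (use AB(1) X(1) in blast)
      then have "K - Z \<in> U" using U(2) by blast
      then show False using disj[OF U(1) Z(2)] by blast
    next
      assume "finite (X - Z)"
      then have "finite (B - Z)"
        by (rule rev_finite_subset) (use AB(2) in blast)
      then have "Z \<in> U'" using U'(2) \<open>Z \<subseteq> K\<close> by blast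
      then show False using disj[OF U'(1) Z(3)] by blast
    qed
  qed
  ultimately show ?thesis using U(1) U'(1) by blast
qed

end
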